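(* Let $L=L(a,b)$ be the free Lie ring (Lie algebra over $\mathbb{Z}$) on two letters $a,b$, and for $n\ge 0$ let $C_n=[a,_n b]$ (so $C_0=a$ and $C_{n+1}=[C_n,b]$). Put $\alpha_{0,0}=1$ and, for integers $i,j\ge 0$ with $(i,j)\neq(0,0)$, $$\alpha_{i,j}=2\binom{i+j-1}{j}+\binom{i+j-2}{j-1}-\binom{i+j-2}{j-2}-2\binom{i+j-1}{j-2}.$$ Then for every integer $n\ge 1$ the following identity holds in $L$ (more precisely, in its component $L_{3,3n}$): $$\left[\sum_{k=0}^{\left\lfloor\frac{n+1}{2}\right\rfloor}(-1)^{n+1}\alpha_{n+1-k,\,k}\,[C_{2n+1-k},\,C_{n+k-1}]\,,\ a\right]=\left[\sum_{i=0}^{n}\sum_{j=0}^{\left\lfloor\frac{i}{2}\right\rfloor}(-1)^{i+1}\alpha_{i-j,\,j}\,[C_{n+i-j},\,C_{n+j-1},\,C_{n-i}]\,,\ b\right].$$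
   Context: Brackets with more than two entries are left-normed: $[x_1,\dots,x_n]=[[x_1,\dots,x_{n-1}],x_n]$. $L_{k,m}\subseteq L$ denotes the abelian subgroup generated by all iterated commutators in which $a$ occurs exactly $k$ times and $b$ occurs exactly $m$ times. Binomial coefficients $\binom{n}{k}$ with $k<0$ are equal to $0$ (for any integer $n$). *)

theory Defs
  imports Complex_Main
begin

class lie_ring = ab_group_add +
  fixes bracket :: "'a \<Rightarrow> 'a \<Rightarrow> 'a"  ("\<lbrace>_,/ _\<rbrace>")
  assumes bracket_add_left: "\<lbrace>x + y, z\<rbrace> = \<lbrace>x, z\<rbrace> + \<lbrace>y, z\<rbrace>"
    and bracket_add_right: "\<lbrace>x, y + z\<rbrace> = \<lbrace>x, y\<rbrace> + \<lbrace>x, z\<rbrace>"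
    and bracket_self: "\<lbrace>x, x\<rbrace> = 0"
    and jacobi: "\<lbrace>\<lbrace>x, y\<rbrace>, z\<rbrace> + \<lbrace>\<lbrace>y, z\<rbrace>, x\<rbrace> + \<lbrace>\<lbrace>z, x\<rbrace>, y\<rbrace> = 0"

text \<open>The free Lie ring on a set of letters is the algebra of formal terms in the signature of
  Lie rings modulo the least congruence that enforces the Lie ring axioms. Its universal property
  is lemma \<open>free_lie_universal\<close> below.\<close>

datatype 'a lterm = TGen 'a | TZero | TNeg "'a lterm" | TAdd "'a lterm" "'a lterm"
  | TBr "'a lterm" "'a lterm"

inductive lie_eq :: "'a lterm \<Rightarrow> 'a lterm \<Rightarrow> bool" where
  le_refl: "lie_eq s s"
| le_sym: "lie_eq s t \<Longrightarrow> lie_eq t s"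
| le_trans: "lie_eq s t \<Longrightarrow> lie_eq t u \<Longrightarrow> lie_eq s u"
| le_neg: "lie_eq s t \<Longrightarrow> lie_eq (TNeg s) (TNeg t)"
| le_add: "lie_eq s s' \<Longrightarrow> lie_eq t t' \<Longrightarrow> lie_eq (TAdd s t) (TAdd s' t')"
| le_br: "lie_eq s s' \<Longrightarrow> lie_eq t t' \<Longrightarrow> lie_eq (TBr s t) (TBr s' t')"
| le_assoc: "lie_eq (TAdd (TAdd s t) u) (TAdd s (TAdd t u))"
| le_comm: "lie_eq (TAdd s t) (TAdd t s)"
| le_zero: "lie_eq (TAdd TZero s) s"
| le_inv: "lie_eq (TAdd (TNeg s) s) TZero"
| le_add_left: "lie_eq (TBr (TAdd s t) u) (TAdd (TBr s u) (TBr t u))"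
| le_add_right: "lie_eq (TBr s (TAdd t u)) (TAdd (TBr s t) (TBr s u))"
| le_self: "lie_eq (TBr s s) TZero"
| le_jacobi: "lie_eq (TAdd (TAdd (TBr (TBr s t) u) (TBr (TBr t u) s)) (TBr (TBr u s) t)) TZero"

quotient_type 'a free_lie = "'a lterm" / lie_eq
  by (rule equivpI) (auto intro!: reflpI sympI transpI intro: lie_eq.intros)

lift_definition gen :: "'a \<Rightarrow> 'a free_lie" is TGen .

instantiation free_lie :: (type) lie_ring
begin

lift_definition zero_free_lie :: "'a free_lie" is TZero .
lift_definition uminus_free_lie :: "'a free_lie \<Rightarrow> 'a free_lie" is TNeg
  by (rule le_neg)
lift_definition plus_free_lie :: "'a free_lie \<Rightarrow> 'a free_lie \<Rightarrow> 'a free_lie" is TAdd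
  by (rule le_add)
lift_definition bracket_free_lie :: "'a free_lie \<Rightarrow> 'a free_lie \<Rightarrow> 'a free_lie" is TBr
  by (rule le_br)
definition minus_free_lie :: "'a free_lie \<Rightarrow> 'a free_lie \<Rightarrow> 'a free_lie" where
  "minus_free_lie x y = x + - y"

instance
proof
  fix x y z :: "'a free_lie"
  show "x + y + z = x + (y + z)" by transfer (rule le_assoc)
  show "x + y = y + x" by transfer (rule le_comm)
  show "0 + x = x" by transfer (rule le_zero)
  show "- x + x = 0" by transfer (rule le_inv)
  show "x - y = x + - y" by (rule minus_free_lie_def)
  show "\<lbrace>x + y, z\<rbrace> = \<lbrace>x, z\<rbrace> + \<lbrace>y, z\<rbrace>" by transfer (rule le_add_left)
  show "\<lbrace>x, y + z\<rbrace> = \<lbrace>x, y\<rbrace> + \<lbrace>x, z\<rbrace>" by transfer (rule le_add_right)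
  show "\<lbrace>x, x\<rbrace> = 0" by transfer (rule le_self)
  show "\<lbrace>\<lbrace>x, y\<rbrace>, z\<rbrace> + \<lbrace>\<lbrace>y, z\<rbrace>, x\<rbrace> + \<lbrace>\<lbrace>z, x\<rbrace>, y\<rbrace> = 0" by transfer (rule le_jacobi)
qed

end

definition lie_hom :: "('a::lie_ring \<Rightarrow> 'b::lie_ring) \<Rightarrow> bool" where
  "lie_hom h \<longleftrightarrow> (\<forall>x y. h (x + y) = h x + h y) \<and> (\<forall>x y. h \<lbrace>x, y\<rbrace> = \<lbrace>h x, h y\<rbrace>)"

primrec lterm_eval :: "('a \<Rightarrow> 'b::lie_ring) \<Rightarrow> 'a lterm \<Rightarrow> 'b" where
  "lterm_eval f (TGen x) = f x"
| "lterm_eval f TZero = 0"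
| "lterm_eval f (TNeg s) = - lterm_eval f s"
| "lterm_eval f (TAdd s t) = lterm_eval f s + lterm_eval f t"
| "lterm_eval f (TBr s t) = \<lbrace>lterm_eval f s, lterm_eval f t\<rbrace>"

lemma lterm_eval_cong: "lie_eq s t \<Longrightarrow> lterm_eval f s = lterm_eval f t"
  by (induction rule: lie_eq.induct)
    (simp_all add: bracket_add_left bracket_add_right bracket_self jacobi[simplified add.assoc]
      ac_simps)

lift_definition free_lie_eval :: "('a \<Rightarrow> 'b::lie_ring) \<Rightarrow> 'a free_lie \<Rightarrow> 'b" is lterm_eval
  by (rule lterm_eval_cong)

lemma lie_hom_free_lie_eval: "lie_hom (free_lie_eval f)"
  unfolding lie_hom_def by (intro conjI allI; transfer; simp)

lemma free_lie_eval_gen: "free_lie_eval f (gen x) = f x"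
  by transfer simp

lemma lie_hom_zero: "lie_hom h \<Longrightarrow> h 0 = 0"
  unfolding lie_hom_def by (metis add_cancel_right_right)

lemma lie_hom_minus: "lie_hom h \<Longrightarrow> h (- x) = - h x"
  using lie_hom_zero[of h] unfolding lie_hom_def
  by (metis add.left_inverse minus_unique add.commute)

lemma free_lie_hom_ext:
  assumes h: "lie_hom h" and g: "lie_hom g" and gen: "\<And>x. h (gen x) = g (gen x)"
  shows "h = g"
proof
  fix x
  have "h (abs_free_lie t) = g (abs_free_lie t)" for t
  proof (induction t)
    case (TGen x)
    then show ?case using gen by (simp add: gen.abs_eq)
  next
    case TZero
    then show ?case using lie_hom_zero[OF h] lie_hom_zero[OF g] by (simp add: zero_free_lie_def)
  next
    case (TNeg t)
    then show ?case
      using lie_hom_minus[OF h] lie_hom_minus[OF g] by (metis uminus_free_lie.abs_eq)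
  next
    case (TAdd s t)
    then show ?case using h g unfolding lie_hom_def by (metis plus_free_lie.abs_eq)
  next
    case (TBr s t)
    then show ?case using h g unfolding lie_hom_def by (metis bracket_free_lie.abs_eq)
  qed
  then show "h x = g x" by (metis Quotient_abs_rep[OF Quotient_free_lie])
qed

lemma free_lie_universal:
  fixes f :: "'a \<Rightarrow> 'b::lie_ring"
  shows "\<exists>!h. lie_hom h \<and> (\<forall>x. h (gen x) = f x)"
proof (rule ex1I[of _ "free_lie_eval f"])
  show "lie_hom (free_lie_eval f) \<and> (\<forall>x. free_lie_eval f (gen x) = f x)"
    by (simp add: lie_hom_free_lie_eval free_lie_eval_gen)
  show "h = free_lie_eval f" if "lie_hom h \<and> (\<forall>x. h (gen x) = f x)" for h
    using that by (intro free_lie_hom_ext) (auto simp: lie_hom_free_lie_eval free_lie_eval_gen)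
qed

definition zscale :: "int \<Rightarrow> 'a::ab_group_add \<Rightarrow> 'a"  (infixr "\<cdot>" 75) where
  "k \<cdot> x = (if 0 \<le> k then ((+) x ^^ nat k) 0 else - ((+) x ^^ nat (- k)) 0)"

lemma zscale_Suc: "int (Suc n) \<cdot> x = x + int n \<cdot> x"
  by (simp add: zscale_def nat_add_distrib del: of_nat_Suc)

lemma zscale_neg: "(- k) \<cdot> x = - (k \<cdot> x)"
  by (auto simp: zscale_def)

datatype letter = Letter_a | Letter_b

type_synonym lie_ab = "letter free_lie"

abbreviation gen_a :: lie_ab where "gen_a \<equiv> gen Letter_a"
abbreviation gen_b :: lie_ab where "gen_b \<equiv> gen Letter_b"

primrec C :: "nat \<Rightarrow> lie_ab" where
  "C 0 = gen_a"
| "C (Suc n) = \<lbrace>C n, gen_b\<rbrace>"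

text \<open>\<open>iter_comm k m x\<close>: \<open>x\<close> is the value of some iterated commutator, with arbitrary bracketing,
  in which \<open>a\<close> occurs \<open>k\<close> times and \<open>b\<close> occurs \<open>m\<close> times.\<close>

inductive iter_comm :: "nat \<Rightarrow> nat \<Rightarrow> lie_ab \<Rightarrow> bool" where
  "iter_comm 1 0 gen_a"
| "iter_comm 0 1 gen_b"
| "iter_comm k m x \<Longrightarrow> iter_comm k' m' y \<Longrightarrow> iter_comm (k + k') (m + m') \<lbrace>x, y\<rbrace>"

inductive_set lie_component :: "nat \<Rightarrow> nat \<Rightarrow> lie_ab set" for k m :: nat where
  "iter_comm k m x \<Longrightarrow> x \<in> lie_component k m"
| "0 \<in> lie_component k m"
| "x \<in> lie_component k m \<Longrightarrow> y \<in> lie_component k m \<Longrightarrow> x + y \<in> lie_component k m"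
| "x \<in> lie_component k m \<Longrightarrow> - x \<in> lie_component k m"

text \<open>Binomial coefficients with an arbitrary integer upper argument, for instance
  \<open>binom (-1) 0 = 1\<close> in \<open>alpha 0 1\<close>. The product is the definition of \<open>gchoose\<close>, written out because
  the type constraint that \<open>Binomial\<close> installs for \<open>gchoose\<close> excludes type \<open>int\<close>; the integer
  division is exact, see \<open>of_int_binom\<close>.\<close>

definition binom :: "int \<Rightarrow> int \<Rightarrow> int" where
  "binom n k = (if k < 0 then 0 else (\<Prod>i = 0..<nat k. n - int i) div fact (nat k))"

lemma of_int_binom:
  "of_int (binom n k) = (if k < 0 then 0 else (of_int n :: 'a::field_char_0) gchoose nat k)"
  using of_int_gbinomial[of n "nat k", where 'a = 'a]
  by (simp add: binom_def gbinomial_prod_rev[where 'a = int])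

definition alpha :: "nat \<Rightarrow> nat \<Rightarrow> int" where
  "alpha i j = (if i = 0 \<and> j = 0 then 1
     else 2 * binom (int i + int j - 1) (int j) + binom (int i + int j - 2) (int j - 1)
        - binom (int i + int j - 2) (int j - 2) - 2 * binom (int i + int j - 1) (int j - 2))"

end

theory Submission imports Defs begin

text \<open>Bracketing with \<open>b\<close> on the right is a derivation that maps \<open>C m\<close> to \<open>C (m + 1)\<close>.
  Differentiating the summands with index \<open>i\<close> on the right-hand side produces commutators with last
  entry \<open>C (n - i)\<close> or \<open>C (n - i + 1)\<close>; because \<open>alpha\<close> obeys Pascal's rule, the sum over \<open>i\<close>
  telescopes and only the commutators with last entry \<open>C 0 = a\<close> survive. The Pascal recursion is
  truncated at the diagonal, where \<open>alpha m (m + 1) = 0\<close> for \<open>m \<ge> 1\<close>; the exception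
  \<open>alpha 0 1 = 1\<close> is accounted for by one use of the Jacobi identity.\<close>

section \<open>Integer multiples\<close>

lemma zscale_zero_left: "0 \<cdot> x = (0 :: 'a::ab_group_add)"
  by (simp add: zscale_def)

lemma zscale_add_one: "(k + 1) \<cdot> x = x + k \<cdot> (x :: 'a::ab_group_add)"
proof (cases "0 \<le> k")
  case True
  then obtain m where "k = int m" by (metis nonneg_int_cases)
  then show ?thesis using zscale_Suc[of m x] by (simp add: add.commute)
next
  case False
  define m where "m = nat (- k - 1)"
  have k: "k = - int (Suc m)" "k + 1 = - int m" using False by (auto simp: m_def)
  show ?thesis unfolding k(2) unfolding k(1) zscale_neg zscale_Suc by simp
qed

lemma zscale_one: "1 \<cdot> x = (x :: 'a::ab_group_add)"
  using zscale_add_one[of 0 x] by (simp add: zscale_zero_left)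

lemma zscale_diff_one: "(k - 1) \<cdot> x = k \<cdot> x - (x :: 'a::ab_group_add)"
  using zscale_add_one[of "k - 1" x] by (simp add: algebra_simps)

lemma zscale_zero_right: "k \<cdot> (0 :: 'a::ab_group_add) = 0"
  by (induction k rule: int_induct[where k = 0])
    (simp_all add: zscale_zero_left zscale_add_one zscale_diff_one)

lemma zscale_add_right: "k \<cdot> (x + y) = k \<cdot> x + k \<cdot> (y :: 'a::ab_group_add)"
  by (induction k rule: int_induct[where k = 0])
    (simp_all add: zscale_zero_left zscale_add_one zscale_diff_one algebra_simps)

lemma zscale_add_left: "(k + l) \<cdot> x = k \<cdot> x + l \<cdot> (x :: 'a::ab_group_add)"
proof (induction k rule: int_induct[where k = 0])
  case (step1 i)
  then show ?case using zscale_add_one[of "i + l" x] zscale_add_one[of i x]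
    by (simp add: algebra_simps)
next
  case (step2 i)
  have "(i - 1 + l) \<cdot> x = (i + l - 1) \<cdot> x" by (simp add: algebra_simps)
  with step2 show ?case by (simp add: zscale_diff_one)
qed (simp add: zscale_zero_left)

lemma zscale_zscale: "k \<cdot> l \<cdot> x = (k * l) \<cdot> (x :: 'a::ab_group_add)"
  by (induction k rule: int_induct[where k = 0])
    (simp_all add: zscale_zero_left zscale_one zscale_diff_one zscale_add_left
      left_diff_distrib distrib_right zscale_neg diff_conv_add_uminus del: add_uminus_conv_diff)

text \<open>Gives access to module lemmas such as \<open>zscale.scale_sum_right\<close>, which moves
  signs in and out of sums.\<close>

interpretation zscale: module "zscale :: int \<Rightarrow> 'a \<Rightarrow> 'a::ab_group_add"
  by standard (simp_all add: zscale_one zscale_add_right zscale_add_left zscale_zscale)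

section \<open>Calculus in Lie rings\<close>

lemma bracket_zero_left: "\<lbrace>0, x\<rbrace> = (0 :: 'a::lie_ring)"
  using bracket_add_left[of 0 0 x] by simp

lemma bracket_minus_left: "\<lbrace>- x, y\<rbrace> = - \<lbrace>x, y :: 'a::lie_ring\<rbrace>"
  using bracket_add_left[of "- x" x y] by (simp add: bracket_zero_left eq_neg_iff_add_eq_0)

lemma bracket_diff_left: "\<lbrace>x - y, z\<rbrace> = \<lbrace>x, z\<rbrace> - \<lbrace>y, z :: 'a::lie_ring\<rbrace>"
  using bracket_add_left[of x "- y" z] by (simp add: bracket_minus_left)

lemma bracket_anticommute: "\<lbrace>x, y\<rbrace> = - \<lbrace>y, x :: 'a::lie_ring\<rbrace>"
proof -
  have "\<lbrace>x, y\<rbrace> + \<lbrace>y, x\<rbrace> = 0"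
    using bracket_self[of "x + y", unfolded bracket_add_left bracket_add_right]
    by (simp add: bracket_self add.commute)
  then show ?thesis by (simp only: eq_neg_iff_add_eq_0)
qed

lemma bracket_sum_left: "\<lbrace>\<Sum>i\<in>A. f i, y\<rbrace> = (\<Sum>i\<in>A. \<lbrace>f i, y :: 'a::lie_ring\<rbrace>)"
  by (induction A rule: infinite_finite_induct) (simp_all add: bracket_zero_left bracket_add_left)

lemma bracket_zscale_left: "\<lbrace>k \<cdot> x, y\<rbrace> = k \<cdot> \<lbrace>x, y :: 'a::lie_ring\<rbrace>"
  by (induction k rule: int_induct[where k = 0])
    (simp_all add: zscale_zero_left zscale_add_one zscale_diff_one bracket_zero_left
      bracket_add_left bracket_diff_left)

text \<open>This is the Jacobi identity with two of its terms reversed by anticommutativity.\<close>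

lemma bracket_derivation:
  "\<lbrace>\<lbrace>x, y\<rbrace>, z\<rbrace> = \<lbrace>\<lbrace>x, z\<rbrace>, y\<rbrace> + \<lbrace>x, \<lbrace>y, z :: 'a::lie_ring\<rbrace>\<rbrace>"
proof -
  have "\<lbrace>\<lbrace>z, x\<rbrace>, y\<rbrace> = - \<lbrace>\<lbrace>x, z\<rbrace>, y\<rbrace>"
    by (metis bracket_anticommute bracket_minus_left)
  moreover have "\<lbrace>\<lbrace>y, z\<rbrace>, x\<rbrace> = - \<lbrace>x, \<lbrace>y, z\<rbrace>\<rbrace>"
    by (rule bracket_anticommute)
  ultimately show ?thesis
    using jacobi[of x y z] by (simp add: algebra_simps)
qed

lemma bracket_derivation3:
  "\<lbrace>\<lbrace>\<lbrace>x, y\<rbrace>, z\<rbrace>, d\<rbrace>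
    = \<lbrace>\<lbrace>\<lbrace>x, d\<rbrace>, y\<rbrace>, z\<rbrace> + \<lbrace>\<lbrace>x, \<lbrace>y, d\<rbrace>\<rbrace>, z\<rbrace> + \<lbrace>\<lbrace>x, y\<rbrace>, \<lbrace>z, d :: 'a::lie_ring\<rbrace>\<rbrace>"
  using bracket_derivation[of "\<lbrace>x, y\<rbrace>" z d] bracket_derivation[of x y d]
  by (simp add: bracket_add_left)

section \<open>The coefficients\<close>

text \<open>Negative \<open>n\<close> is included, which \<open>alpha_Pascal\<close> needs at
  \<open>i = j = 0\<close>. For positive \<open>k\<close> the identity is checked over the
  rationals, where \<open>of_int_binom\<close> turns \<open>binom\<close> into
  \<open>gchoose\<close>.\<close>

lemma binom_Pascal: "binom (n + 1) k = binom n k + binom n (k - 1)"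
proof -
  consider "k < 0" | "k = 0" | m where "k = int (Suc m)"
    by (metis linorder_neqE_linordered_idom zero_less_imp_eq_int gr0_conv_Suc)
  then show ?thesis
  proof cases
    case (3 m)
    have "(of_int (binom (n + 1) k) :: rat) = of_int (binom n k + binom n (k - 1))"
      using gbinomial_Suc_Suc[of "of_int n :: rat" m] 3
      by (simp add: of_int_binom nat_add_distrib add.commute)
    then show ?thesis by (simp only: of_int_eq_iff)
  qed (simp_all add: binom_def)
qed

lemma binom_of_nat: "binom (int n) (int k) = int (n choose k)"
proof -
  have "(of_int (binom (int n) (int k)) :: rat) = of_int (int (n choose k))"
    by (simp add: of_int_binom binomial_gbinomial)
  then show ?thesis by (simp only: of_int_eq_iff)
qed

text \<open>In each of the four terms of \<open>alpha\<close> the upper argument is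
  \<open>i + j\<close> and the lower one \<open>j\<close>, up to constant shifts, so Pascal's rule
  applies term by term. The exceptional value \<open>alpha 0 0\<close> does not occur.\<close>

lemma alpha_Pascal: "alpha (Suc i) (Suc j) = alpha i (Suc j) + alpha (Suc i) j"
proof -
  let ?s = "int i + int j"
  have "binom (?s + 1) k = binom ?s k + binom ?s (k - 1)"
    "binom ?s k = binom (?s - 1) k + binom (?s - 1) (k - 1)" for k
    using binom_Pascal[of ?s k] binom_Pascal[of "?s - 1" k] by simp_all
  from this(1)[of "int j + 1"] this(1)[of "int j - 1"] this(2)[of "int j"] this(2)[of "int j - 1"]
  show ?thesis by (simp add: alpha_def algebra_simps)
qed

lemma alpha_0_right: "alpha (Suc i) 0 = 2"
  by (simp add: alpha_def binom_def)

lemma alpha_0_1: "alpha 0 1 = 1"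
  by (simp add: alpha_def binom_def)

text \<open>By the symmetry of binomial coefficients the first term cancels the fourth and the
  second cancels the third. For \<open>m = 0\<close> the symmetry breaks down at the upper argument
  -1.\<close>

lemma alpha_diagonal:
  assumes "m \<ge> 1"
  shows "alpha m (Suc m) = 0"
proof -
  obtain l where m: "m = Suc l" using assms by (metis Suc_le_D One_nat_def)
  have "(2 * l + 2) choose (l + 2) = (2 * l + 2) choose l"
    using binomial_symmetric[of "l + 2" "2 * l + 2"] by simp
  moreover have "(2 * l + 1) choose (l + 1) = (2 * l + 1) choose l"
    using binomial_symmetric[of "l + 1" "2 * l + 1"] by simp
  moreover have "alpha m (Suc m) = 2 * binom (int (2 * l + 2)) (int (l + 2))
      + binom (int (2 * l + 1)) (int (l + 1)) - binom (int (2 * l + 1)) (int l)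
      - 2 * binom (int (2 * l + 2)) (int l)"
    by (simp add: alpha_def m algebra_simps)
  ultimately show ?thesis by (simp only: binom_of_nat)
qed

section \<open>Membership in the graded components\<close>

lemma iter_comm_C: "iter_comm 1 m (C m)"
proof (induction m)
  case (Suc m)
  from iter_comm.intros(3)[OF Suc iter_comm.intros(2)] show ?case by simp
qed (simp add: iter_comm.intros(1)[simplified])

lemma lie_component_zscale: "x \<in> lie_component k m \<Longrightarrow> l \<cdot> x \<in> lie_component k m"
proof (induction l rule: int_induct[where k = 0])
  case (step2 i)
  then have "i \<cdot> x + - x \<in> lie_component k m"
    by (intro lie_component.intros(3,4))
  then show ?case by (simp add: zscale_diff_one)
qed (simp_all add: zscale_zero_left zscale_add_one lie_component.intros)

lemma lie_component_sum:
  "(\<And>i. i \<in> A \<Longrightarrow> f i \<in> lie_component k m) \<Longrightarrow> (\<Sum>i\<in>A. f i) \<in> lie_component k m"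
  by (induction A rule: infinite_finite_induct) (simp_all add: lie_component.intros)

section \<open>Telescoping\<close>

abbreviation (input) T :: "nat \<Rightarrow> nat \<Rightarrow> nat \<Rightarrow> lie_ab" where
  "T p q r \<equiv> \<lbrace>\<lbrace>C p, C q\<rbrace>, C r\<rbrace>"

lemma bracket_T_gen_b: "\<lbrace>T p q r, gen_b\<rbrace> = T (Suc p) q r + T p (Suc q) r + T p q (Suc r)"
  unfolding C.simps by (rule bracket_derivation3)

lemma T_same: "T p p r = 0"
  by (simp add: bracket_self bracket_zero_left)

lemma T_swap: "T p q r = - T q p r"
  by (metis bracket_anticommute bracket_minus_left)

lemma T_jacobi: "T p q r + T q r p + T r p q = 0"
  by (rule jacobi)

lemma T_component:
  assumes "p + q + r = s"
  shows "T p q r \<in> lie_component 3 s"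
  using iter_comm.intros(3)[OF iter_comm.intros(3)[OF iter_comm_C[of p] iter_comm_C[of q]]
      iter_comm_C[of r]] assms
  by (intro lie_component.intros(1)) (simp add: numeral_3_eq_3)

text \<open>On the left, \<open>F k\<close> collects \<open>a k\<close> and
  \<open>a (k - 1)\<close>, and only the last shifted term is left over.\<close>

lemma sum_zscale_Pascal:
  fixes F :: "nat \<Rightarrow> 'a::ab_group_add"
  assumes "a 0 = c 0" and "\<And>k. k < m \<Longrightarrow> c (Suc k) = a (Suc k) + a k"
  shows "(\<Sum>j = 0..m. a j \<cdot> (F j + F (Suc j))) = (\<Sum>k = 0..m. c k \<cdot> F k) + a m \<cdot> F (Suc m)"
  using assms by (induction m) (simp_all add: zscale_add_right zscale_add_left algebra_simps)

text \<open>The leftover term of \<open>sum_zscale_Pascal\<close> vanishes by \<open>F\<close> for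
  even \<open>M\<close>. For odd \<open>M\<close> it is the summand with the largest
  \<open>k\<close> on the right, because the diagonal value of \<open>alpha\<close> is 0; this needs
  \<open>M div 2\<close> positive, hence excludes \<open>M = 1\<close>.\<close>

lemma sum_alpha_Pascal:
  fixes F :: "nat \<Rightarrow> 'a::ab_group_add"
  assumes M: "M \<ge> 2" and F: "even M \<Longrightarrow> F (Suc (M div 2)) = 0"
  shows "(\<Sum>j = 0..M div 2. alpha (M - j) j \<cdot> (F j + F (Suc j)))
    = (\<Sum>k = 0..(M + 1) div 2. alpha (M + 1 - k) k \<cdot> F k)"
proof -
  let ?m = "M div 2"
  have eq: "(\<Sum>j = 0..?m. alpha (M - j) j \<cdot> (F j + F (Suc j)))
    = (\<Sum>k = 0..?m. alpha (M + 1 - k) k \<cdot> F k) + alpha (M - ?m) ?m \<cdot> F (Suc ?m)"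
  proof (rule sum_zscale_Pascal)
    show "alpha (M - 0) 0 = alpha (M + 1 - 0) 0"
      using M alpha_0_right[of "M - 1"] alpha_0_right[of M] by simp
    fix k assume "k < ?m"
    then have "M - k = Suc (M - Suc k)" "M + 1 - Suc k = Suc (M - Suc k)" by auto
    then show "alpha (M + 1 - Suc k) (Suc k) = alpha (M - Suc k) (Suc k) + alpha (M - k) k"
      using alpha_Pascal[of "M - Suc k" k] by simp
  qed
  show ?thesis
  proof (cases "even M")
    case True
    then show ?thesis using eq F by (simp add: zscale_zero_right)
  next
    case False
    then have s: "(M + 1) div 2 = Suc ?m" "M - ?m = Suc ?m" "M + 1 - Suc ?m = Suc ?m"
      by presburger+
    have "alpha (Suc ?m) (Suc ?m) = alpha (Suc ?m) ?m"
      using M by (simp add: alpha_Pascal alpha_diagonal)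
    then show ?thesis unfolding eq s(1) by (simp add: s)
  qed
qed

text \<open>What remains after differentiating the layers 0 to \<open>N\<close>. For
  \<open>N = n\<close> the last entry is \<open>C 0 = a\<close>, which gives the left-hand side of
  the theorem.\<close>

definition top_sum :: "nat \<Rightarrow> nat \<Rightarrow> lie_ab" where
  "top_sum n N = (\<Sum>k = 0..(N + 1) div 2.
     ((-1) ^ (N + 1) * alpha (N + 1 - k) k) \<cdot> T (n + N + 1 - k) (n + k - 1) (n - N))"

definition layer :: "nat \<Rightarrow> nat \<Rightarrow> lie_ab" where
  "layer n i = (\<Sum>j = 0..i div 2.
     ((-1) ^ (i + 1) * alpha (i - j) j) \<cdot> T (n + i - j) (n + j - 1) (n - i))"

text \<open>Differentiating the first two entries gives \<open>top_sum n M\<close> by Pascal's rule;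
  differentiating the last entry gives the previous \<open>top_sum\<close> with the opposite
  sign.\<close>

lemma bracket_layer:
  assumes "2 \<le> M" "M \<le> n"
  shows "\<lbrace>layer n M, gen_b\<rbrace> = top_sum n M - top_sum n (M - 1)"
proof -
  define F where "F k = T (n + M + 1 - k) (n + k - 1) (n - M)" for k
  define s :: int where "s = (-1) ^ (M + 1)"
  \<comment> \<open>Raising the first entry yields \<open>F j\<close>, raising the second yields
    \<open>F (Suc j)\<close>.\<close>
  have D: "\<lbrace>T (n + M - j) (n + j - 1) (n - M), gen_b\<rbrace>
      = F j + F (Suc j) + T (n + M - j) (n + j - 1) (n - (M - 1))"
    if "j \<le> M div 2" for j
  proof -
    have "Suc (n + M - j) = n + M + 1 - j" "Suc (n + j - 1) = n + Suc j - 1"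
      "Suc (n - M) = n - (M - 1)" "n + M - j = n + M + 1 - Suc j"
      using that assms by auto
    then show ?thesis by (simp only: bracket_T_gen_b F_def)
  qed
  have "\<lbrace>layer n M, gen_b\<rbrace> = (\<Sum>j = 0..M div 2. (s * alpha (M - j) j) \<cdot>
      (F j + F (Suc j) + T (n + M - j) (n + j - 1) (n - (M - 1))))"
    unfolding layer_def bracket_sum_left bracket_zscale_left s_def
    by (intro sum.cong refl arg_cong[where f = "zscale _"] D) simp
  also have "\<dots> = s \<cdot> (\<Sum>j = 0..M div 2. alpha (M - j) j \<cdot> (F j + F (Suc j)))
      + (\<Sum>j = 0..M div 2. (s * alpha (M - j) j) \<cdot> T (n + M - j) (n + j - 1) (n - (M - 1)))"
    by (simp only: zscale_add_right[of _ "_ + _"] sum.distrib zscale.scale_sum_right zscale_zscale)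
  also have "(\<Sum>j = 0..M div 2. alpha (M - j) j \<cdot> (F j + F (Suc j)))
      = (\<Sum>k = 0..(M + 1) div 2. alpha (M + 1 - k) k \<cdot> F k)"
  proof (rule sum_alpha_Pascal)
    assume "even M"
    \<comment> \<open>For even \<open>M\<close> the first two entries of this commutator
      coincide.\<close>
    then have "n + M + 1 - Suc (M div 2) = n + Suc (M div 2) - 1" by presburger
    then show "F (Suc (M div 2)) = 0" by (simp only: F_def T_same)
  qed fact
  also have "s \<cdot> \<dots> = top_sum n M"
    by (simp only: top_sum_def F_def s_def zscale.scale_sum_right zscale_zscale)
  also have "(\<Sum>j = 0..M div 2. (s * alpha (M - j) j) \<cdot> T (n + M - j) (n + j - 1) (n - (M - 1)))
      = - top_sum n (M - 1)"
  proof -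
    \<comment> \<open>The coefficients and commutators agree; passing from \<open>M\<close> to
      \<open>N\<close> only flips the sign.\<close>
    obtain N where "M = Suc N" using assms(1) by (metis Suc_le_D numeral_2_eq_2)
    then show ?thesis
      by (simp add: top_sum_def s_def zscale_neg sum_negf)
  qed
  finally show ?thesis by simp
qed

text \<open>The layers 0 and 1 are treated together: \<open>alpha 1 1 = 3\<close>, while layer 1
  alone contributes only \<open>alpha 1 0 = 2\<close>.\<close>

lemma bracket_layer_0_1:
  assumes "1 \<le> n"
  shows "\<lbrace>layer n 0 + layer n 1, gen_b\<rbrace> = top_sum n 1"
proof -
  obtain l where n: "n = Suc l" using assms by (metis Suc_le_D One_nat_def)
  have a: "alpha 0 0 = 1" "alpha (Suc 0) 0 = 2" "alpha (Suc (Suc 0)) 0 = 2" "alpha (Suc 0) (Suc 0) = 3"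
    using alpha_0_right[of 0] alpha_0_right[of 1] alpha_Pascal[of 0 0] alpha_0_1
    by (simp_all add: alpha_def[of 0 0])
  have two: "2 \<cdot> x = x + x" and three: "3 \<cdot> x = x + x + x" for x :: lie_ab
    using zscale_add_one[of 1 x] zscale_add_one[of 2 x] by simp_all
  \<comment> \<open>Jacobi rewrites the term in which layer 0 has its last entry raised. This
    supplies the third copy of \<open>T (n + 1) n (n - 1)\<close> and cancels the surplus
    \<open>T (n + 1) (n - 1) n\<close>.\<close>
  have "T (Suc l) l (Suc (Suc l)) = T (Suc (Suc l)) l (Suc l) - T (Suc (Suc l)) (Suc l) l"
    using T_jacobi[of "Suc l" l "Suc (Suc l)"] T_swap[of l "Suc (Suc l)" "Suc l"]
    by (simp del: C.simps add: algebra_simps eq_neg_iff_add_eq_0)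
  then show ?thesis
    by (simp del: C.simps add: layer_def top_sum_def n a two three bracket_add_left
        bracket_diff_left bracket_T_gen_b T_same zscale_neg bracket_zscale_left)
qed

lemma bracket_sum_layer:
  assumes "1 \<le> N" "N \<le> n"
  shows "\<lbrace>\<Sum>i = 0..N. layer n i, gen_b\<rbrace> = top_sum n N"
  using assms
proof (induction N rule: nat_induct_at_least)
  case base
  then show ?case using bracket_layer_0_1[of n] by simp
next
  case (Suc N)
  then show ?case using bracket_layer[of "Suc N" n] by (simp add: bracket_add_left)
qed

theorem theorem2p3:
  fixes n :: nat
  assumes "n \<ge> 1"
  shows "let lhs = \<lbrace>\<Sum>k = 0..(n + 1) div 2.
                 ((-1) ^ (n + 1) * alpha (n + 1 - k) k) \<cdot> \<lbrace>C (2 * n + 1 - k), C (n + k - 1)\<rbrace>, gen_a\<rbrace>;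
             rhs = \<lbrace>\<Sum>i = 0..n. \<Sum>j = 0..i div 2.
                 ((-1) ^ (i + 1) * alpha (i - j) j) \<cdot> \<lbrace>\<lbrace>C (n + i - j), C (n + j - 1)\<rbrace>, C (n - i)\<rbrace>, gen_b\<rbrace>
         in lhs = rhs \<and> lhs \<in> lie_component 3 (3 * n) \<and> rhs \<in> lie_component 3 (3 * n)"
proof -
  have lhs: "\<lbrace>\<Sum>k = 0..(n + 1) div 2.
      ((-1) ^ (n + 1) * alpha (n + 1 - k) k) \<cdot> \<lbrace>C (2 * n + 1 - k), C (n + k - 1)\<rbrace>, gen_a\<rbrace>
    = top_sum n n"
    unfolding top_sum_def bracket_sum_left bracket_zscale_left mult_2 by simp
  have rhs: "\<lbrace>\<Sum>i = 0..n. layer n i, gen_b\<rbrace> = top_sum n n"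
    using assms by (rule bracket_sum_layer) simp
  have "top_sum n n \<in> lie_component 3 (3 * n)"
    unfolding top_sum_def
  proof (intro lie_component_sum lie_component_zscale T_component)
    \<comment> \<open>As \<open>k\<close> is at most \<open>2 * n + 1\<close> and \<open>n\<close>
      is positive, the truncated subtractions are exact.\<close>
    fix k assume "k \<in> {0..(n + 1) div 2}"
    then show "n + n + 1 - k + (n + k - 1) + (n - n) = 3 * n" using assms by auto
  qed
  then show ?thesis
    using rhs unfolding Let_def lhs layer_def by simp
qed

end
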